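(* Let $I=[a,b]$ with $a<b$, and let $g:I\to\mathbb R$ be nonconstant, left-continuous, and nondecreasing. Then the image $\operatorname{Im}(g)=g(I)$ is uniformly disconnected if and only if $\kappa_g>0$. More precisely, the optimal uniform-disconnectedness constant of $\operatorname{Im}(g)$ equals $\kappa_g$.
   Context: For $D\subset\mathbb R$ and $c\in(0,1]$, $D$ is $c$-uniformly disconnected if, for every pair of distinct points $u,v\in D$ and every finite chain $u=u_0,u_1,\ldots,u_N=v$ with all $u_i\in D$, one has $\max_{1\le i\le N}|u_i-u_{i-1}|\ge c|u-v|$. $D$ is uniformly disconnected if it is $c$-uniformly disconnected for some $c\in(0,1]$. The optimal uniform-disconnectedness constant of $D$ is the largest $c\in(0,1]$ such that $D$ is $c$-uniformly disconnected, with value $0$ if no such $c$ exists. For $\tau\in[a,b)$, set $\Delta^+g(\tau)=g(\tau+)-g(\tau)$, where $g(\tau+)$ is the right limit. For $s<t$ in $I$ set $J_g(s,t)=\sup_{\tau\in[s,t)}\Delta^+g(\tau)$, and $$\kappa_g=\inf_{\substack{a\le s<t\le b\\ g(s)<g(t)}}\frac{J_g(s,t)}{g(t)-g(s)}.$$ *)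

theory Defs
  imports "HOL-Analysis.Analysis"
begin

text \<open>A chain is given by its first \<open>N + 1\<close> terms \<open>p 0, \<dots>, p N\<close>. Since its endpoints
  are distinct, \<open>N \<ge> 1\<close> and the maximum is taken over a nonempty set.\<close>

definition unif_disconnected_const :: "real \<Rightarrow> real set \<Rightarrow> bool" where
  "unif_disconnected_const c D \<longleftrightarrow>
     (\<forall>u\<in>D. \<forall>v\<in>D. u \<noteq> v \<longrightarrow>
       (\<forall>N (p :: nat \<Rightarrow> real). p 0 = u \<and> p N = v \<and> (\<forall>i\<le>N. p i \<in> D) \<longrightarrow>
          (MAX i\<in>{1..N}. \<bar>p i - p (i - 1)\<bar>) \<ge> c * \<bar>u - v\<bar>))"

definition unif_disconnected :: "real set \<Rightarrow> bool" where
  "unif_disconnected D \<longleftrightarrow> (\<exists>c\<in>{0<..1}. unif_disconnected_const c D)"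

text \<open>If some admissible \<open>c\<close> exists, then a largest one does, because the defining
  inequalities are not strict and \<open>c \<le> 1\<close>.\<close>

definition opt_ud_const :: "real set \<Rightarrow> real" where
  "opt_ud_const D =
     (if \<exists>c\<in>{0<..1}. unif_disconnected_const c D
      then GREATEST c. c \<in> {0<..1} \<and> unif_disconnected_const c D
      else 0)"

text \<open>A function on \<open>[a, b]\<close> is represented by a total function on the reals. For
  \<open>a \<le> \<tau> < b\<close> the right limit at \<open>\<tau>\<close> depends only on its values on \<open>[a, b]\<close>.\<close>

definition right_jump :: "(real \<Rightarrow> real) \<Rightarrow> real \<Rightarrow> real" where
  "right_jump g \<tau> = Lim (at_right \<tau>) g - g \<tau>"

text \<open>For \<open>g\<close> nondecreasing on \<open>[a, b]\<close> and \<open>a \<le> s < t \<le> b\<close>, the jumps lie between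
  \<open>0\<close> and \<open>g t - g s\<close>, so the supremum and infimum below are of bounded sets.\<close>

definition max_jump :: "(real \<Rightarrow> real) \<Rightarrow> real \<Rightarrow> real \<Rightarrow> real" where
  "max_jump g s t = (SUP \<tau>\<in>{s..<t}. right_jump g \<tau>)"

definition jump_ratio :: "real \<Rightarrow> real \<Rightarrow> (real \<Rightarrow> real) \<Rightarrow> real" where
  "jump_ratio a b g =
     Inf {max_jump g s t / (g t - g s) | s t. a \<le> s \<and> s < t \<and> t \<le> b \<and> g s < g t}"

end

theory Submission
  imports Defs
begin

text \<open>A chain in the image has to cross every gap \<open>(g \<tau>, g (\<tau>+))\<close> in one step, so its largest
  step is at least the largest jump between the endpoints. Conversely, if all jumps on \<open>[s, t)\<close> are
  bounded by some number less than \<open>\<epsilon>\<close>, then the supremum of the points whose values can be reached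
  from \<open>g s\<close> by steps less than \<open>\<epsilon>\<close> is itself reachable by left continuity, and it equals \<open>t\<close>
  because otherwise a short step to the right would be possible.\<close>

section \<open>Right jumps of a nondecreasing function\<close>

text \<open>Monotonicity makes the right limit exist and equal the infimum of the values to the
  right. Convergence has to come first, since \<open>Lim\<close> is a description operator and says
  nothing otherwise.\<close>

lemma right_jump_eq_Inf:
  fixes g :: "real \<Rightarrow> real"
  assumes mono: "mono_on {a..b} g" and \<tau>: "a \<le> \<tau>" "\<tau> < b"
  shows "right_jump g \<tau> = Inf (g ` {\<tau><..b}) - g \<tau>"
proof -
  have eq: "{\<tau><..} \<inter> {a..b} = {\<tau><..b}"
    using \<tau> by auto
  have "(g \<longlongrightarrow> Inf (g ` ({\<tau><..} \<inter> {a..b}))) (at \<tau> within ({\<tau><..} \<inter> {a..b}))"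
  proof (rule Lim_right_bound)
    show "g x \<le> g y" if "x \<in> {a..b}" "y \<in> {a..b}" "\<tau> < x" "x \<le> y" for x y
      using mono that by (auto simp: mono_on_def)
    show "g \<tau> \<le> g x" if "x \<in> {a..b}" "\<tau> < x" for x
      using mono that \<tau> by (auto simp: mono_on_def)
  qed
  \<comment> \<open>The set \<open>{..<b}\<close> is an open neighbourhood of \<tau> on which the
    two domains \<open>{\<tau><..b}\<close> and \<open>{\<tau><..}\<close> agree.\<close>
  moreover have "at \<tau> within {\<tau><..b} = at_right \<tau>"
    using \<tau> by (intro at_within_nhd[where S = "{..<b}"]) auto
  ultimately have "(g \<longlongrightarrow> Inf (g ` {\<tau><..b})) (at_right \<tau>)"
    by (simp add: eq)
  then have "Lim (at_right \<tau>) g = Inf (g ` {\<tau><..b})"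
    by (intro tendsto_Lim) simp_all
  then show ?thesis
    by (simp add: right_jump_def)
qed

lemma right_jump_le:
  fixes g :: "real \<Rightarrow> real"
  assumes mono: "mono_on {a..b} g" and \<tau>: "a \<le> \<tau>" "\<tau> < r" "r \<le> b"
  shows "right_jump g \<tau> \<le> g r - g \<tau>"
proof -
  have "bdd_below (g ` {\<tau><..b})"
    using mono \<tau> by (intro bdd_belowI[where m = "g \<tau>"]) (auto simp: mono_on_def)
  then have "Inf (g ` {\<tau><..b}) \<le> g r"
    using \<tau> by (intro cInf_lower) auto
  then show ?thesis
    using right_jump_eq_Inf[OF mono] \<tau> by simp
qed

lemma right_jump_nonneg:
  fixes g :: "real \<Rightarrow> real"
  assumes mono: "mono_on {a..b} g" and \<tau>: "a \<le> \<tau>" "\<tau> < b"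
  shows "0 \<le> right_jump g \<tau>"
proof -
  have "g \<tau> \<le> Inf (g ` {\<tau><..b})"
    using mono \<tau> by (intro cInf_greatest) (auto simp: mono_on_def)
  then show ?thesis
    using right_jump_eq_Inf[OF mono \<tau>] by simp
qed

lemma right_jump_less_witness:
  fixes g :: "real \<Rightarrow> real"
  assumes mono: "mono_on {a..b} g" and \<tau>: "a \<le> \<tau>" "\<tau> < t" "t \<le> b"
    and less: "right_jump g \<tau> < e"
  obtains r where "\<tau> < r" "r \<le> t" "g r - g \<tau> < e"
proof -
  have "Inf (g ` {\<tau><..b}) < g \<tau> + e"
    using right_jump_eq_Inf[OF mono] \<tau> less by simp
  moreover have "g ` {\<tau><..b} \<noteq> {}"
    using \<tau> by simp
  ultimately have "\<exists>y\<in>g ` {\<tau><..b}. y < g \<tau> + e"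
    by (intro cInf_lessD)
  then obtain r where r: "\<tau> < r" "r \<le> b" "g r < g \<tau> + e"
    by auto
  \<comment> \<open>The infimum gives a point anywhere up to \<open>b\<close>; moving it left to at
    most \<open>t\<close> only lowers its value.\<close>
  have "g (min r t) \<le> g r"
    using mono \<tau> r by (auto simp: mono_on_def)
  then show thesis
    using that[of "min r t"] r \<tau> by auto
qed

section \<open>Suprema of jumps and the jump ratio\<close>

lemma max_jump_bounds:
  fixes g :: "real \<Rightarrow> real"
  assumes mono: "mono_on {a..b} g" and st: "a \<le> s" "s < t" "t \<le> b"
  shows right_jump_le_max_jump: "\<And>\<tau>. \<tau> \<in> {s..<t} \<Longrightarrow> right_jump g \<tau> \<le> max_jump g s t"
    and max_jump_nonneg: "0 \<le> max_jump g s t"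
    and max_jump_le: "max_jump g s t \<le> g t - g s"
proof -
  \<comment> \<open>This common bound also makes the set of jumps bounded above, so that its real
    supremum is meaningful.\<close>
  have le: "right_jump g \<tau> \<le> g t - g s" if "\<tau> \<in> {s..<t}" for \<tau>
  proof -
    have "right_jump g \<tau> \<le> g t - g \<tau>" "g s \<le> g \<tau>"
      using that st mono by (auto intro: right_jump_le[OF mono] simp: mono_on_def)
    then show ?thesis by simp
  qed
  show jump: "right_jump g \<tau> \<le> max_jump g s t" if "\<tau> \<in> {s..<t}" for \<tau>
    unfolding max_jump_def using that le
    by (intro cSUP_upper bdd_aboveI2[where M = "g t - g s"]) auto
  show "0 \<le> max_jump g s t"
    using jump[of s] right_jump_nonneg[OF mono, of s] st by simp
  show "max_jump g s t \<le> g t - g s"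
    unfolding max_jump_def using st le by (intro cSUP_least) auto
qed

text \<open>The equivalence trades the infimum for one inequality per pair, free of division.
  Nonconstancy makes the set of ratios nonempty, and nonnegative jumps bound it below, so its
  infimum is a genuine one.\<close>

lemma le_jump_ratio_iff:
  fixes g :: "real \<Rightarrow> real"
  assumes mono: "mono_on {a..b} g" and nonconst: "\<not> g constant_on {a..b}"
  shows "c \<le> jump_ratio a b g \<longleftrightarrow>
    (\<forall>s t. a \<le> s \<and> s < t \<and> t \<le> b \<and> g s < g t \<longrightarrow> c * (g t - g s) \<le> max_jump g s t)"
    and jump_ratio_nonneg: "0 \<le> jump_ratio a b g"
    and jump_ratio_le_1: "jump_ratio a b g \<le> 1"
proof -
  define A where
    "A = {max_jump g s t / (g t - g s) | s t. a \<le> s \<and> s < t \<and> t \<le> b \<and> g s < g t}"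
  have ratio: "jump_ratio a b g = Inf A"
    by (simp add: jump_ratio_def A_def)
  obtain x y where xy: "x \<in> {a..b}" "y \<in> {a..b}" "g x < g y"
    using nonconst unfolding constant_on_def by (metis linorder_less_linear)
  have "x < y"
    using mono xy unfolding mono_on_def by (meson not_le)
  with xy have xyA: "max_jump g x y / (g y - g x) \<in> A"
    unfolding A_def by auto
  have lower: "0 \<le> z" if "z \<in> A" for z
    using that max_jump_nonneg[OF mono] by (auto simp: A_def intro!: divide_nonneg_nonneg)
  then have bdd: "bdd_below A"
    by (rule bdd_belowI)
  show "0 \<le> jump_ratio a b g"
    unfolding ratio using xyA lower by (intro cInf_greatest) auto
  have "Inf A \<le> max_jump g x y / (g y - g x)"
    using xyA bdd by (rule cInf_lower)
  also have "\<dots> \<le> 1"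
    using max_jump_le[OF mono, of x y] xy \<open>x < y\<close> by simp
  finally show "jump_ratio a b g \<le> 1"
    by (simp add: ratio)
  have "c \<le> jump_ratio a b g \<longleftrightarrow> (\<forall>z\<in>A. c \<le> z)"
    unfolding ratio using xyA by (intro le_cInf_iff bdd) auto
  also have "\<dots> \<longleftrightarrow>
    (\<forall>s t. a \<le> s \<and> s < t \<and> t \<le> b \<and> g s < g t \<longrightarrow> c \<le> max_jump g s t / (g t - g s))"
    unfolding A_def by blast
  also have "\<dots> \<longleftrightarrow>
    (\<forall>s t. a \<le> s \<and> s < t \<and> t \<le> b \<and> g s < g t \<longrightarrow> c * (g t - g s) \<le> max_jump g s t)"
    by (simp add: pos_le_divide_eq)
  finally show "c \<le> jump_ratio a b g \<longleftrightarrow>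
    (\<forall>s t. a \<le> s \<and> s < t \<and> t \<le> b \<and> g s < g t \<longrightarrow> c * (g t - g s) \<le> max_jump g s t)" .
qed

section \<open>Lower bound: every chain crosses every gap\<close>

text \<open>Take the first index whose value is at least \<open>y\<close>. Its predecessor is below
  \<open>y\<close>, hence at most \<open>x\<close>, so this single step spans the gap.\<close>

lemma chain_crosses_gap:
  fixes p :: "nat \<Rightarrow> real"
  assumes "x < y" "p 0 \<le> x" "y \<le> p N" and gap: "\<And>i. i \<le> N \<Longrightarrow> p i \<le> x \<or> y \<le> p i"
  obtains i where "i \<in> {1..N}" "y - x \<le> \<bar>p i - p (i - 1)\<bar>"
proof -
  define i where "i = (LEAST i. y \<le> p i)"
  have i: "y \<le> p i" "i \<le> N"
    unfolding i_def using \<open>y \<le> p N\<close> by (auto intro: LeastI Least_le)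
  have "i \<noteq> 0"
    using i assms by (intro notI) simp
  then have "\<not> y \<le> p (i - 1)"
    unfolding i_def by (intro not_less_Least) simp
  then have "p (i - 1) \<le> x"
    using gap[of "i - 1"] i by auto
  with i \<open>i \<noteq> 0\<close> show thesis
    by (intro that[of i]) auto
qed

text \<open>The image misses the open interval from \<open>g \<tau>\<close> to the right limit:
  arguments up to \<tau> have values at most \<open>g \<tau>\<close>, later ones at least the limit.
  Both orders of the endpoints occur because uniform disconnectedness does not order
  \<open>u\<close> and \<open>v\<close>.\<close>

lemma right_jump_le_chain_step:
  fixes g :: "real \<Rightarrow> real" and p :: "nat \<Rightarrow> real"
  assumes mono: "mono_on {a..b} g" and st: "a \<le> s" "s \<le> \<tau>" "\<tau> < t" "t \<le> b" "g s < g t"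
    and p: "\<And>i. i \<le> N \<Longrightarrow> p i \<in> g ` {a..b}"
    and ends: "p 0 = g s \<and> p N = g t \<or> p 0 = g t \<and> p N = g s"
  shows "right_jump g \<tau> \<le> (MAX i\<in>{1..N}. \<bar>p i - p (i - 1)\<bar>)"
proof -
  let ?M = "MAX i\<in>{1..N}. \<bar>p i - p (i - 1)\<bar>"
  have M: "\<bar>p i - p (i - 1)\<bar> \<le> ?M" if "i \<in> {1..N}" for i
    using that by (intro Max_ge) auto
  show ?thesis
  proof (cases "right_jump g \<tau> = 0")
    \<comment> \<open>There is no gap of positive length here. Distinct endpoints force
      \<open>N \<noteq> 0\<close>, so the maximum is over a nonempty set of absolute values and is
      nonnegative.\<close>
    case True
    have "N \<noteq> 0"
      using ends st(5) by (metis less_irrefl)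
    then have "\<bar>p 1 - p (1 - 1)\<bar> \<le> ?M"
      by (intro M) simp
    then show ?thesis
      using True by (smt (verit) abs_ge_zero)
  next
    case False
    define y where "y = g \<tau> + right_jump g \<tau>"
    have "g \<tau> < y"
      using False right_jump_nonneg[OF mono, of \<tau>] st by (simp add: y_def)
    have gs: "g s \<le> g \<tau>"
      using mono st by (auto simp: mono_on_def)
    have gt: "y \<le> g t"
      using right_jump_le[OF mono, of \<tau> t] st by (simp add: y_def)
    have gap: "p i \<le> g \<tau> \<or> y \<le> p i" if i: "i \<le> N" for i
    proof -
      obtain r where r: "p i = g r" "r \<in> {a..b}"
        using p[OF i] by auto
      show ?thesis
      proof (cases "r \<le> \<tau>")
        case True
        then show ?thesis
          using mono r st by (auto simp: mono_on_def)
      next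
        case False
        then show ?thesis
          using right_jump_le[OF mono, of \<tau> r] r st by (simp add: y_def)
      qed
    qed
    from ends obtain i where "i \<in> {1..N}" "y - g \<tau> \<le> \<bar>p i - p (i - 1)\<bar>"
    proof
      assume e: "p 0 = g s \<and> p N = g t"
      show thesis
        by (rule chain_crosses_gap[of "g \<tau>" y p N])
          (use e gs gt \<open>g \<tau> < y\<close> gap that in auto)
    next
      \<comment> \<open>Negating the chain turns the descent into an ascent across the reflected
        gap.\<close>
      assume e: "p 0 = g t \<and> p N = g s"
      show thesis
      proof (rule chain_crosses_gap[of "- y" "- g \<tau>" "\<lambda>i. - p i" N])
        show "- p i \<le> - y \<or> - g \<tau> \<le> - p i" if "i \<le> N" for i
          using gap[OF that] by auto
      qed (use e gs gt \<open>g \<tau> < y\<close> that in auto)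
    qed
    then have "y - g \<tau> \<le> ?M"
      using M order_trans by blast
    then show ?thesis
      by (simp add: y_def)
  qed
qed

text \<open>The largest step of a chain bounds each jump between its endpoints, hence also their
  supremum, whether or not it is attained.\<close>

lemma unif_disconnected_const_if_le_max_jump:
  fixes g :: "real \<Rightarrow> real"
  assumes mono: "mono_on {a..b} g"
    and le: "\<And>s t. a \<le> s \<Longrightarrow> s < t \<Longrightarrow> t \<le> b \<Longrightarrow> g s < g t \<Longrightarrow> c * (g t - g s) \<le> max_jump g s t"
  shows "unif_disconnected_const c (g ` {a..b})"
proof -
  have main: "c * (g t - g s) \<le> (MAX i\<in>{1..N}. \<bar>p i - p (i - 1)\<bar>)"
    if st: "s \<in> {a..b}" "t \<in> {a..b}" "g s < g t"
      and p: "\<And>i. i \<le> N \<Longrightarrow> p i \<in> g ` {a..b}"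
      and ends: "p 0 = g s \<and> p N = g t \<or> p 0 = g t \<and> p N = g s"
    for s t N and p :: "nat \<Rightarrow> real"
  proof -
    have "s < t"
      using mono st unfolding mono_on_def by (meson not_le)
    then have "c * (g t - g s) \<le> max_jump g s t"
      using st by (intro le) auto
    also have "\<dots> \<le> (MAX i\<in>{1..N}. \<bar>p i - p (i - 1)\<bar>)"
      unfolding max_jump_def using \<open>s < t\<close> st p ends
      by (intro cSUP_least right_jump_le_chain_step[OF mono, of s _ t]) auto
    finally show ?thesis .
  qed
  show ?thesis
    unfolding unif_disconnected_const_def
  proof (intro ballI impI allI, elim conjE)
    fix u v N and p :: "nat \<Rightarrow> real"
    assume uv: "u \<in> g ` {a..b}" "v \<in> g ` {a..b}" "u \<noteq> v"
      and p: "p 0 = u" "p N = v" "\<forall>i\<le>N. p i \<in> g ` {a..b}"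
    obtain s t where st: "s \<in> {a..b}" "u = g s" "t \<in> {a..b}" "v = g t"
      using uv by auto
    show "c * \<bar>u - v\<bar> \<le> (MAX i\<in>{1..N}. \<bar>p i - p (i - 1)\<bar>)"
    proof (cases "u < v")
      case True
      then show ?thesis
        using main[of s t N p] st p by auto
    next
      case False
      then show ?thesis
        using main[of t s N p] st p uv by auto
    qed
  qed
qed

section \<open>Upper bound: building chains with short steps\<close>

text \<open>Bounding each step separately avoids the maximum over the empty set, so the chain with
  \<open>N = 0\<close> can start the construction.\<close>

definition short_chain :: "real set \<Rightarrow> real \<Rightarrow> real \<Rightarrow> real \<Rightarrow> bool" where
  "short_chain D e u v \<longleftrightarrow> (\<exists>N (p :: nat \<Rightarrow> real). p 0 = u \<and> p N = v \<and> (\<forall>i\<le>N. p i \<in> D) \<and>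
     (\<forall>i\<in>{1..N}. \<bar>p i - p (i - 1)\<bar> < e))"

lemma short_chain_refl: "u \<in> D \<Longrightarrow> short_chain D e u u"
  unfolding short_chain_def by (intro exI[of _ 0] exI[of _ "\<lambda>_. u"]) simp

lemma short_chain_step:
  assumes "short_chain D e u v" "w \<in> D" "\<bar>w - v\<bar> < e"
  shows "short_chain D e u w"
proof -
  obtain N and p :: "nat \<Rightarrow> real"
    where p: "p 0 = u" "p N = v" "\<forall>i\<le>N. p i \<in> D" "\<forall>i\<in>{1..N}. \<bar>p i - p (i - 1)\<bar> < e"
    using assms(1) unfolding short_chain_def by blast
  define q where "q = p(Suc N := w)"
  have q: "q i = p i" if "i \<le> N" for i
    using that by (simp add: q_def)
  have "q i \<in> D" if "i \<le> Suc N" for i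
    using that p(3) assms(2) by (cases "i = Suc N") (simp_all add: q_def)
  moreover have "\<bar>q i - q (i - 1)\<bar> < e" if "i \<in> {1..Suc N}" for i
  proof (cases "i = Suc N")
    case True
    then show ?thesis
      using p(2) assms(3) by (simp add: q_def)
  next
    case False
    with that have i: "i \<in> {1..N}" by simp
    then show ?thesis
      using p(4) q[of i] q[of "i - 1"] by auto
  qed
  moreover have "q 0 = u" "q (Suc N) = w"
    using p(1) by (simp_all add: q_def)
  ultimately show ?thesis
    unfolding short_chain_def by blast
qed

lemma short_chain_if_right_jump_le:
  fixes g :: "real \<Rightarrow> real"
  assumes mono: "mono_on {a..b} g"
    and cont: "\<And>t. t \<in> {a<..b} \<Longrightarrow> continuous (at_left t) g"
    and st: "a \<le> s" "s \<le> t" "t \<le> b" and e: "0 < e"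
    and jump: "\<And>\<tau>. \<tau> \<in> {s..<t} \<Longrightarrow> right_jump g \<tau> < e"
  shows "short_chain (g ` {a..b}) e (g s) (g t)"
proof -
  define S where "S = {r \<in> {s..t}. short_chain (g ` {a..b}) e (g s) (g r)}"
  \<comment> \<open>One more step reaches \<open>g r'\<close>; monotonicity turns the one-sided
    bound into one on the absolute value.\<close>
  have extend: "r' \<in> S" if "r \<in> S" "r \<le> r'" "r' \<le> t" "g r' - g r < e" for r r'
  proof -
    have "g r \<le> g r'"
      using mono that st by (auto simp: mono_on_def S_def)
    then show ?thesis
      using that st unfolding S_def by (auto intro: short_chain_step)
  qed
  have "s \<in> S"
    using st unfolding S_def by (auto intro: short_chain_refl)
  have bdd: "bdd_above S"
    by (rule bdd_aboveI[of _ t]) (auto simp: S_def)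
  define m where "m = Sup S"
  have "s \<le> m"
    unfolding m_def using \<open>s \<in> S\<close> bdd by (rule cSup_upper)
  have "m \<le> t"
    unfolding m_def using \<open>s \<in> S\<close> by (intro cSup_least) (auto simp: S_def)
  have "m \<in> S"
  proof (cases "m = s")
    case True
    then show ?thesis
      using \<open>s \<in> S\<close> by simp
  next
    case False
    with \<open>s \<le> m\<close> have "s < m" by simp
    then have "continuous (at_left m) g"
      using st \<open>m \<le> t\<close> by (intro cont) auto
    then have "(g \<longlongrightarrow> g m) (at_left m)"
      by (simp add: continuous_within)
    then have "\<forall>\<^sub>F r in at_left m. g m - e < g r"
      using e by (intro order_tendstoD(1)) auto
    then obtain l where l: "l < m" "\<And>r. l < r \<Longrightarrow> r < m \<Longrightarrow> g m - e < g r"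
      using \<open>s < m\<close> by (auto simp: eventually_at_left[of s m])
    \<comment> \<open>As \<open>m\<close> is the supremum of \<open>S\<close>, some reachable point
      lies beyond \<open>l\<close>, and from there left continuity leaves less than \<open>e\<close>
      to climb to \<open>g m\<close>.\<close>
    obtain r where r: "r \<in> S" "l < r"
      using less_cSupD[of S l] l(1) \<open>s \<in> S\<close> unfolding m_def by auto
    have "r \<le> m"
      unfolding m_def using r(1) bdd by (rule cSup_upper)
    have "g m - g r < e"
      using l(2)[of r] r \<open>r \<le> m\<close> e by (cases "r = m") auto
    then show ?thesis
      using extend r \<open>r \<le> m\<close> \<open>m \<le> t\<close> by blast
  qed
  have "m = t"
  proof (rule ccontr)
    assume "m \<noteq> t"
    with \<open>m \<le> t\<close> have "m < t" by simp
    \<comment> \<open>The jump bound is used at the single point \<open>m\<close>: it yields a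
      reachable point to the right of the supremum.\<close>
    then have "right_jump g m < e"
      using \<open>s \<le> m\<close> by (intro jump) auto
    then obtain r where r: "m < r" "r \<le> t" "g r - g m < e"
      using right_jump_less_witness[OF mono, of m t] \<open>s \<le> m\<close> \<open>m < t\<close> st by auto
    then have "r \<in> S"
      using extend[of m r] \<open>m \<in> S\<close> by auto
    then have "r \<le> m"
      unfolding m_def using bdd by (rule cSup_upper)
    then show False
      using r by simp
  qed
  with \<open>m \<in> S\<close> show ?thesis
    by (simp add: S_def)
qed

text \<open>A maximum of finitely many steps, each less than \<open>e\<close>, is itself less than
  \<open>e\<close>; here \<open>u \<noteq> v\<close> ensures that there is a step.\<close>

lemma unif_disconnected_const_short_chain:
  assumes "unif_disconnected_const c D" "short_chain D e u v" "u \<noteq> v"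
  shows "c * \<bar>u - v\<bar> < e"
proof -
  obtain N and p :: "nat \<Rightarrow> real"
    where p: "p 0 = u" "p N = v" "\<forall>i\<le>N. p i \<in> D" "\<forall>i\<in>{1..N}. \<bar>p i - p (i - 1)\<bar> < e"
    using assms(2) unfolding short_chain_def by blast
  have "N \<noteq> 0"
    using p(1,2) assms(3) by metis
  have "p 0 \<in> D" "p N \<in> D"
    using p(3) by simp_all
  then have "c * \<bar>u - v\<bar> \<le> (MAX i\<in>{1..N}. \<bar>p i - p (i - 1)\<bar>)"
    using assms(1,3) p(1-3) unfolding unif_disconnected_const_def by simp
  also have "\<dots> < e"
    using p(4) \<open>N \<noteq> 0\<close> by (subst Max_less_iff) auto
  finally show ?thesis .
qed

section \<open>Admissible constants and the optimal one\<close>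

lemma unif_disconnected_const_iff:
  fixes g :: "real \<Rightarrow> real"
  assumes mono: "mono_on {a..b} g" and nonconst: "\<not> g constant_on {a..b}"
    and cont: "\<And>t. t \<in> {a<..b} \<Longrightarrow> continuous (at_left t) g" and "0 < c"
  shows "unif_disconnected_const c (g ` {a..b}) \<longleftrightarrow> c \<le> jump_ratio a b g"
proof
  assume "c \<le> jump_ratio a b g"
  then show "unif_disconnected_const c (g ` {a..b})"
    unfolding le_jump_ratio_iff[OF mono nonconst]
    by (intro unif_disconnected_const_if_le_max_jump[OF mono]) blast
next
  assume ud: "unif_disconnected_const c (g ` {a..b})"
  show "c \<le> jump_ratio a b g"
    unfolding le_jump_ratio_iff[OF mono nonconst]
  proof (intro allI impI, elim conjE)
    fix s t assume st: "a \<le> s" "s < t" "t \<le> b" "g s < g t"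
    show "c * (g t - g s) \<le> max_jump g s t"
    proof (rule ccontr)
      assume less: "\<not> c * (g t - g s) \<le> max_jump g s t"
      \<comment> \<open>The step bound is taken to be the very length that uniform disconnectedness
        demands, so a chain with strictly shorter steps is contradictory.\<close>
      have "right_jump g \<tau> < c * (g t - g s)" if "\<tau> \<in> {s..<t}" for \<tau>
        using right_jump_le_max_jump[OF mono st(1-3) that] less by simp
      then have "short_chain (g ` {a..b}) (c * (g t - g s)) (g s) (g t)"
        using st \<open>0 < c\<close> by (intro short_chain_if_right_jump_le[OF mono cont]) auto
      then have "c * \<bar>g s - g t\<bar> < c * (g t - g s)"
        using st by (intro unif_disconnected_const_short_chain[OF ud]) auto
      then show False
        using st by simp
    qed
  qed
qed

theorem corollary5p3:
  fixes a b :: real and g :: "real \<Rightarrow> real"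
  assumes "a < b"
    and "\<not> g constant_on {a..b}"
    and "\<And>t. t \<in> {a<..b} \<Longrightarrow> continuous (at_left t) g"
    and "mono_on {a..b} g"
  shows "(unif_disconnected (g ` {a..b}) \<longleftrightarrow> jump_ratio a b g > 0) \<and>
         opt_ud_const (g ` {a..b}) = jump_ratio a b g"
proof -
  let ?k = "jump_ratio a b g" and ?D = "g ` {a..b}"
  have k: "0 \<le> ?k" "?k \<le> 1"
    using jump_ratio_nonneg jump_ratio_le_1 assms by blast+
  \<comment> \<open>Since \<open>?k \<le> 1\<close>, the admissible constants form exactly the
    interval \<open>{0<..?k}\<close>.\<close>
  have iff: "c \<in> {0<..1} \<and> unif_disconnected_const c ?D \<longleftrightarrow> 0 < c \<and> c \<le> ?k" for c
    using unif_disconnected_const_iff[OF assms(4,2,3), of c] k by auto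
  have ex: "(\<exists>c\<in>{0<..1}. unif_disconnected_const c ?D) \<longleftrightarrow> 0 < ?k"
    unfolding Bex_def iff by (meson less_le_trans order_refl)
  \<comment> \<open>A nonempty interval \<open>{0<..?k}\<close> contains its right endpoint, so the
    optimum is attained. For \<open>?k = 0\<close> the default value 0 agrees with
    \<open>?k\<close>.\<close>
  have "(GREATEST c. 0 < c \<and> c \<le> ?k) = ?k" if "0 < ?k"
    using that by (intro Greatest_equality) auto
  then have "opt_ud_const ?D = ?k"
    unfolding opt_ud_const_def ex iff using k by auto
  then show ?thesis
    unfolding unif_disconnected_def ex by simp
qed

end
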